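(* Let $(\delta_n)_{n\in\mathbb{N}}$ be a sequence of real numbers, let $(\gamma_n)_{n\in\mathbb{N}}$ be a sequence of strictly positive real numbers, and let $(\sigma_n)_{n\in\mathbb{N}}$ be a sequence of real numbers with $\sigma_n\neq 0$ for all $n\in\mathbb{N}$. Let $(U_n)_{n\in\mathbb{N}}$ be a sequence of independent Cauchy random variables, where $U_n$ has location parameter $\delta_n$ and scale parameter $\gamma_n$, and let $(W_n)_{n\in\mathbb{N}}$ be a sequence of independent Cauchy random variables, where $W_n$ has location parameter $\delta_n$ and scale parameter $\sigma_n\gamma_n$ (that is, scale $|\sigma_n|\gamma_n$). Then the laws of $(U_n)_{n\in\mathbb{N}}$ and $(W_n)_{n\in\mathbb{N}}$ (as probability measures on $\mathbb{R}^{\mathbb{N}}$) are equivalent if and only if $\sum_{n\in\mathbb{N}}(|\sigma_n|-1)^2<\infty$.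
   Context: A Cauchy random variable with location parameter $\delta\in\mathbb{R}$ and scale parameter $\gamma>0$ is a real random variable with Lebesgue density $x\mapsto \frac{1}{\pi\gamma}\frac{\gamma^2}{(x-\delta)^2+\gamma^2}$. A nonzero, possibly negative, scale parameter $\gamma$ is interpreted as the scale $|\gamma|$; thus $W_n$ has density $x\mapsto \frac{1}{\pi|\sigma_n|\gamma_n}\frac{\sigma_n^2\gamma_n^2}{(x-\delta_n)^2+\sigma_n^2\gamma_n^2}$. The law of a sequence of independent random variables is the countable product of the individual laws on $\mathbb{R}^{\mathbb{N}}$ with the product Borel $\sigma$-algebra. Two measures are equivalent if they are mutually absolutely continuous. *)

theory Defs
  imports "HOL-Probability.Probability"
begin

text \<open>A nonzero, possibly negative, scale parameter \<open>\<gamma>\<close> is read as the scale \<open>\<bar>\<gamma>\<bar>\<close>; for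
  \<open>\<gamma> > 0\<close> this is the usual density. For \<open>\<gamma> = 0\<close> the function is identically zero, hence not a
  probability density.\<close>

definition cauchy_density :: "real \<Rightarrow> real \<Rightarrow> real \<Rightarrow> real" where
  "cauchy_density \<delta> \<gamma> x = 1 / (pi * \<bar>\<gamma>\<bar>) * (\<gamma>\<^sup>2 / ((x - \<delta>)\<^sup>2 + \<gamma>\<^sup>2))"

definition cauchy_rv :: "'a measure \<Rightarrow> ('a \<Rightarrow> real) \<Rightarrow> real \<Rightarrow> real \<Rightarrow> bool" where
  "cauchy_rv M X \<delta> \<gamma> \<longleftrightarrow> distributed M lborel X (\<lambda>x. ennreal (cauchy_density \<delta> \<gamma> x))"

definition sequence_law :: "'a measure \<Rightarrow> (nat \<Rightarrow> 'a \<Rightarrow> real) \<Rightarrow> (nat \<Rightarrow> real) measure" where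
  "sequence_law M X = distr M (\<Pi>\<^sub>M n\<in>UNIV. borel) (\<lambda>\<omega> n. X n \<omega>)"

text \<open>\<^const>\<open>absolutely_continuous\<close> only compares null sets, so the common \<open>\<sigma>\<close>-algebra is
  required explicitly.\<close>

definition equivalent_measures :: "'a measure \<Rightarrow> 'a measure \<Rightarrow> bool" where
  "equivalent_measures M N \<longleftrightarrow>
     sets M = sets N \<and> absolutely_continuous M N \<and> absolutely_continuous N M"

end

theory Submission
  imports Defs "HOL-Real_Asymp.Real_Asymp"
begin

text \<open>If the series converges, the likelihood ratios of the coordinates have second moments
  \<open>1 + (\<bar>\<sigma>\<^sub>n\<bar> - 1)\<^sup>2 / (2 \<bar>\<sigma>\<^sub>n\<bar>)\<close>, whose products stay bounded. By Cauchy--Schwarz the two laws \<open>P\<close>, \<open>Q\<close>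
  then satisfy \<open>Q(A)\<^sup>2 \<le> C P(A)\<close> for cylinders \<open>A\<close>, hence for open sets, and outer regularity gives
  absolute continuity. The second moment is symmetric in the two scales, so the roles can be
  exchanged.

  If the series diverges, let \<open>d\<^sub>n\<close> be the difference of the probabilities that the two \<open>n\<close>-th
  coordinates lie within \<open>\<gamma>\<^sub>n\<close> of \<open>\<delta>\<^sub>n\<close>. Then \<open>\<Sum> d\<^sub>n\<^sup>2\<close> diverges as well, and by Hoeffding's inequality
  and Borel--Cantelli the sums of the indicators of these events, weighted by \<open>d\<^sub>n\<close>, separate the
  two laws.\<close>

section \<open>Domination of infinite products through second moments of densities\<close>

text \<open>A measure on a finite product is determined by its values on measurable boxes. There the
  indicator factorises like the density, so Tonelli splits the integral into one factor per
  coordinate.\<close>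

lemma PiM_density_finite:
  assumes "finite I" and "\<And>i. prob_space (p i)" and "\<And>i. prob_space (q i)"
    and r[measurable]: "\<And>i. r i \<in> borel_measurable (p i)"
    and q: "\<And>i. q i = density (p i) (r i)"
  shows "PiM I q = density (PiM I p) (\<lambda>x. \<Prod>i\<in>I. r i (x i))"
proof -
  interpret p: product_prob_space p I
    using assms(2) by (intro product_prob_spaceI) auto
  interpret q: product_prob_space q I
    using assms(3) by (intro product_prob_spaceI) auto
  have sets_q: "sets (q i) = sets (p i)" for i
    by (simp add: q)
  show ?thesis
  proof (rule q.PiM_eqI[symmetric])
    show "sets (density (PiM I p) (\<lambda>x. \<Prod>i\<in>I. r i (x i))) = sets (PiM I q)"
      by (simp, rule sets_PiM_cong) (simp_all add: sets_q)
  next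
    fix A assume A: "\<And>i. i \<in> I \<Longrightarrow> A i \<in> sets (q i)"
    then have A'[measurable]: "A i \<in> sets (p i)" if "i \<in> I" for i
      using that by (simp add: sets_q)
    have ind: "indicator (Pi\<^sub>E I A) x = (\<Prod>i\<in>I. indicator (A i) (x i) :: ennreal)"
      if "x \<in> space (PiM I p)" for x
    proof (cases "\<forall>i\<in>I. x i \<in> A i")
      case True
      then show ?thesis using that by (simp add: space_PiM PiE_iff)
    next
      case False
      then have "(\<Prod>i\<in>I. indicator (A i) (x i) :: ennreal) = 0"
        using \<open>finite I\<close> by (auto simp: indicator_def intro!: prod_zero)
      then show ?thesis using False by (auto simp: indicator_def PiE_iff)
    qed
    have "emeasure (density (PiM I p) (\<lambda>x. \<Prod>i\<in>I. r i (x i))) (Pi\<^sub>E I A)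
        = (\<integral>\<^sup>+x. (\<Prod>i\<in>I. r i (x i)) * indicator (Pi\<^sub>E I A) x \<partial>PiM I p)"
      by (rule emeasure_density) (use A' \<open>finite I\<close> in \<open>auto intro!: sets_PiM_I_finite\<close>)
    also have "\<dots> = (\<integral>\<^sup>+x. (\<Prod>i\<in>I. r i (x i) * indicator (A i) (x i)) \<partial>PiM I p)"
      by (intro nn_integral_cong) (simp add: ind prod.distrib)
    also have "\<dots> = (\<Prod>i\<in>I. \<integral>\<^sup>+x. r i x * indicator (A i) x \<partial>p i)"
      by (intro p.product_nn_integral_prod \<open>finite I\<close>) auto
    also have "\<dots> = (\<Prod>i\<in>I. emeasure (q i) (A i))"
      unfolding q by (intro prod.cong) (auto simp: emeasure_density)
    finally show "emeasure (density (PiM I p) (\<lambda>x. \<Prod>i\<in>I. r i (x i))) (Pi\<^sub>E I A)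
        = (\<Prod>i\<in>I. emeasure (q i) (A i))" .
  qed (fact \<open>finite I\<close>)
qed

text \<open>Cauchy-Schwarz is applied to the product density times the indicator of
  \<open>A\<close>. The squared density factorises again, so the constant depends on
  \<open>I\<close> only through a product of one-dimensional second moments.\<close>

lemma PiM_emeasure_square_le:
  assumes "finite I" and "\<And>i. prob_space (p i)" and "\<And>i. prob_space (q i)"
    and r[measurable]: "\<And>i. r i \<in> borel_measurable (p i)"
    and q: "\<And>i. q i = density (p i) (r i)"
    and A[measurable]: "A \<in> sets (PiM I p)"
  shows "(emeasure (PiM I q) A)\<^sup>2 \<le> (\<Prod>i\<in>I. \<integral>\<^sup>+x. (r i x)\<^sup>2 \<partial>p i) * emeasure (PiM I p) A"
proof -
  interpret p: product_prob_space p I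
    using assms(2) by (intro product_prob_spaceI) auto
  have "emeasure (PiM I q) A = (\<integral>\<^sup>+x. (\<Prod>i\<in>I. r i (x i)) * indicator A x \<partial>PiM I p)"
    by (simp add: PiM_density_finite[OF assms(1-5)] emeasure_density)
  then have "(emeasure (PiM I q) A)\<^sup>2
      \<le> (\<integral>\<^sup>+x. (\<Prod>i\<in>I. r i (x i))\<^sup>2 \<partial>PiM I p) * (\<integral>\<^sup>+x. (indicator A x)\<^sup>2 \<partial>PiM I p)"
    by (simp only:) (rule Cauchy_Schwarz_nn_integral; measurable)
  also have "(\<integral>\<^sup>+x. (\<Prod>i\<in>I. r i (x i))\<^sup>2 \<partial>PiM I p) = (\<Prod>i\<in>I. \<integral>\<^sup>+x. (r i x)\<^sup>2 \<partial>p i)"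
    unfolding prod_power_distrib by (intro p.product_nn_integral_prod \<open>finite I\<close>) auto
  also have "(\<integral>\<^sup>+x. (indicator A x)\<^sup>2 \<partial>PiM I p) = (\<integral>\<^sup>+x. indicator A x \<partial>PiM I p)"
    by (intro nn_integral_cong) (simp add: indicator_def)
  also have "\<dots> = emeasure (PiM I p) A"
    by simp
  finally show ?thesis .
qed

text \<open>The product topology has a countable basis of boxes with finitely many nontrivial sides;
  the sets sought are the finite unions along an enumeration of the boxes that make up
  \<open>U\<close>. Estimates for cylinders thereby reach open sets by continuity from
  below.\<close>

lemma open_fun_incseq_cylinders:
  fixes U :: "('i::countable \<Rightarrow> 'a::second_countable_topology) set"
  assumes "open U"
  obtains J A where "\<And>n. finite (J n)" "\<And>n. A n \<in> sets (\<Pi>\<^sub>M i\<in>J n. borel)"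
    "incseq (\<lambda>n. (\<lambda>x. restrict x (J n)) -` A n)" "U = (\<Union>n::nat. (\<lambda>x. restrict x (J n)) -` A n)"
proof -
  obtain K :: "('i \<Rightarrow> 'a) set set" where K: "topological_basis K" "countable K"
    "\<And>k. k \<in> K \<Longrightarrow> \<exists>X. k = Pi\<^sub>E UNIV X \<and> (\<forall>i. open (X i)) \<and> finite {i. X i \<noteq> UNIV}"
    using product_topology_countable_basis by fast
  obtain B where B: "B \<subseteq> K" "\<Union>B = U"
    using K(1) assms by (auto simp: topological_basis_def)
  \<comment> \<open>Adding the empty set guarantees an enumeration by the naturals even when
    \<open>B\<close> is empty.\<close>
  have "countable (insert {} B)"
    using B(1) K(2) countable_subset by blast
  then obtain f :: "nat \<Rightarrow> ('i \<Rightarrow> 'a) set" where f: "range f = insert {} B"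
    by (metis range_from_nat_into insert_not_empty)
  have "\<exists>X. f n = Pi\<^sub>E UNIV X \<and> (\<forall>i. X i \<in> sets borel) \<and> finite {i. X i \<noteq> UNIV}" for n
  proof (cases "f n = {}")
    case True
    \<comment> \<open>The empty set is a box with a single empty side, placed at the arbitrary index
      \<open>undefined\<close>; all other sides are \<open>UNIV\<close>.\<close>
    then show ?thesis
      by (intro exI[of _ "(\<lambda>_. UNIV)(undefined := {})"]) (auto simp: PiE_eq_empty_iff split: if_splits)
  next
    case False
    then have "f n \<in> K" using f B(1) by blast
    from K(3)[OF this] show ?thesis by (blast intro: borel_open)
  qed
  then obtain X where X: "\<And>n. f n = Pi\<^sub>E UNIV (X n)" "\<And>n i. X n i \<in> sets borel"
      "\<And>n. finite {i. X n i \<noteq> UNIV}"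
    by metis
  \<comment> \<open>\<open>J n\<close> collects the coordinates constrained by any of the boxes
    \<open>f 0\<close> to \<open>f n\<close>. Each of these boxes is then a cylinder over the same
    finite set \<open>J n\<close>, and so is their union.\<close>
  define J where "J n = (\<Union>m\<le>n. {i. X m i \<noteq> UNIV})" for n
  define A where "A n = (\<Union>m\<le>n. Pi\<^sub>E (J n) (X m))" for n
  have eq: "(\<lambda>x. restrict x (J n)) -` A n = (\<Union>m\<le>n. f m)" for n
  proof -
    have "(\<lambda>x. restrict x (J n)) -` Pi\<^sub>E (J n) (X m) = f m" if "m \<le> n" for m
    proof -
      have "X m i = UNIV" if "i \<notin> J n" for i
        using that \<open>m \<le> n\<close> by (auto simp: J_def)
      then show ?thesis
        unfolding X(1) by (auto simp: PiE_iff) (metis UNIV_I)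
    qed
    then show ?thesis by (simp add: A_def vimage_UN)
  qed
  have fin: "finite (J n)" for n
    unfolding J_def using X(3) by blast
  show ?thesis
  proof (rule that[of J A])
    show "A n \<in> sets (\<Pi>\<^sub>M i\<in>J n. borel)" for n
      unfolding A_def using fin X(2) by (intro sets.finite_UN sets_PiM_I_finite) auto
    show "incseq (\<lambda>n. (\<lambda>x. restrict x (J n)) -` A n)"
      unfolding eq by (intro monoI UN_mono) auto
    have "(\<Union>n. \<Union>m\<le>n. f m) = \<Union>(range f)" by auto
    then show "U = (\<Union>n. (\<lambda>x. restrict x (J n)) -` A n)"
      unfolding eq using f B(2) by simp
  qed (fact fin)
qed

text \<open>The inequality \<open>Q(A)\<^sup>2 \<le> C * P(A)\<close>, for the product laws P of
  \<open>p\<close> and Q of \<open>q\<close>, survives increasing limits and so passes from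
  cylinders to open sets. Over a countable index set the product sigma-algebra is the Borel one of a
  Polish space, so P-null sets have open supersets of arbitrarily small P-measure.\<close>

lemma absolutely_continuous_PiM:
  fixes p q :: "'i::countable \<Rightarrow> 'a::polish_space measure"
  assumes p: "\<And>i. prob_space (p i)" and q: "\<And>i. prob_space (q i)"
    and sets_p: "\<And>i. sets (p i) = sets borel"
    and r: "\<And>i. r i \<in> borel_measurable (p i)"
    and dens: "\<And>i. q i = density (p i) (r i)"
    and C: "\<And>J. finite J \<Longrightarrow> (\<Prod>i\<in>J. \<integral>\<^sup>+x. (r i x)\<^sup>2 \<partial>p i) \<le> ennreal C"
  shows "absolutely_continuous (PiM UNIV p) (PiM UNIV q)"
proof -
  interpret p: product_prob_space p UNIV
    using p by (intro product_prob_spaceI) auto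
  interpret q: product_prob_space q UNIV
    using q by (intro product_prob_spaceI) auto
  \<comment> \<open>The empty product equals 1, which makes \<open>C\<close> positive and allows
    division by it below.\<close>
  have "ennreal 1 \<le> ennreal C" using C[of "{}"] by simp
  then have C1: "1 \<le> C" using ennreal_le_iff2 by force
  have sets_q: "sets (q i) = sets borel" for i
    by (simp add: dens sets_p)
  have space_p: "space (p i) = UNIV" and space_q: "space (q i) = UNIV" for i
    by (simp_all add: sets_eq_imp_space_eq[OF sets_p] sets_eq_imp_space_eq[OF sets_q])
  have sets_Pp: "sets (PiM J p) = sets (\<Pi>\<^sub>M i\<in>J. borel)" for J
    by (intro sets_PiM_cong) (auto simp: sets_p)
  have sets_Pq: "sets (PiM J q) = sets (\<Pi>\<^sub>M i\<in>J. borel)" for J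
    by (intro sets_PiM_cong) (auto simp: sets_q)
  have sets_P: "sets (PiM UNIV p) = sets borel"
    using sets_Pp[of UNIV] sets_PiM_equal_borel[where 'a='i and 'b='a] by simp
  have sets_Q: "sets (PiM UNIV q) = sets borel"
    using sets_Pq[of UNIV] sets_PiM_equal_borel[where 'a='i and 'b='a] by simp
  have cylinder: "(measure (PiM UNIV q) ((\<lambda>x. restrict x J) -` A))\<^sup>2
      \<le> C * measure (PiM UNIV p) ((\<lambda>x. restrict x J) -` A)"
    if J: "finite J" and A: "A \<in> sets (\<Pi>\<^sub>M i\<in>J. borel)" for J A
  proof -
    let ?S = "(\<lambda>x. restrict x J) -` A"
    \<comment> \<open>All factors have the full type as space, so the preimage under
      \<open>restrict\<close> is exactly the embedded cylinder, and its measure is that of its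
      finite-dimensional base.\<close>
    have "emeasure (PiM UNIV p) ?S = emeasure (PiM J p) A"
      using p.emeasure_PiM_emb'[of J A] J A by (simp add: sets_Pp prod_emb_def space_p)
    moreover have "emeasure (PiM UNIV q) ?S = emeasure (PiM J q) A"
      using q.emeasure_PiM_emb'[of J A] J A by (simp add: sets_Pq prod_emb_def space_q)
    moreover have "A \<in> sets (PiM J p)"
      using A sets_Pp[of J] by blast
    then have "(emeasure (PiM J q) A)\<^sup>2
        \<le> (\<Prod>i\<in>J. \<integral>\<^sup>+x. (r i x)\<^sup>2 \<partial>p i) * emeasure (PiM J p) A"
      by (rule PiM_emeasure_square_le[where p = p and q = q and r = r, OF J p q r dens])
    then have "(emeasure (PiM J q) A)\<^sup>2 \<le> ennreal C * emeasure (PiM J p) A"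
      by (rule order_trans) (rule mult_right_mono[OF C[OF J] zero_le])
    ultimately have "(emeasure (PiM UNIV q) ?S)\<^sup>2 \<le> ennreal C * emeasure (PiM UNIV p) ?S"
      by (simp only:)
    then have "ennreal ((measure (PiM UNIV q) ?S)\<^sup>2) \<le> ennreal (C * measure (PiM UNIV p) ?S)"
      using C1 by (simp only: p.P.emeasure_eq_measure q.P.emeasure_eq_measure
          ennreal_power[OF measure_nonneg] ennreal_mult'[OF order_trans[OF zero_le_one C1]])
    then show ?thesis
      using C1 by (subst (asm) ennreal_le_iff) auto
  qed
  have opn: "(measure (PiM UNIV q) U)\<^sup>2 \<le> C * measure (PiM UNIV p) U" if U: "open U" for U
  proof -
    obtain J A where JA: "\<And>n. finite (J n)" "\<And>n. A n \<in> sets (\<Pi>\<^sub>M i\<in>J n. borel)"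
        "incseq (\<lambda>n. (\<lambda>x. restrict x (J n)) -` A n)"
        "U = (\<Union>n::nat. (\<lambda>x. restrict x (J n)) -` A n)"
      by (rule open_fun_incseq_cylinders[OF U, of thesis]) blast
    have meas: "(\<lambda>x. restrict x (J n)) -` A n \<in> sets (PiM UNIV p)" for n
      using measurable_sets[OF measurable_restrict_subset[of "J n" UNIV "\<lambda>_. borel"] JA(2)[of n]]
      by (simp add: sets_Pp space_PiM)
    have meas_q: "(\<lambda>x. restrict x (J n)) -` A n \<in> sets (PiM UNIV q)" for n
      using meas sets_P sets_Q by simp
    have "(\<lambda>n. measure (PiM UNIV p) ((\<lambda>x. restrict x (J n)) -` A n)) \<longlonglongrightarrow> measure (PiM UNIV p) U"
      unfolding JA(4) by (intro p.P.finite_Lim_measure_incseq JA) (use meas in auto)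
    moreover have "(\<lambda>n. measure (PiM UNIV q) ((\<lambda>x. restrict x (J n)) -` A n))
        \<longlonglongrightarrow> measure (PiM UNIV q) U"
      unfolding JA(4) by (intro q.P.finite_Lim_measure_incseq JA) (use meas_q in auto)
    ultimately show ?thesis
      by (intro LIMSEQ_le[OF tendsto_power tendsto_mult[OF tendsto_const]])
         (auto intro!: cylinder JA)
  qed
  have "A \<in> null_sets (PiM UNIV q)" if A: "A \<in> null_sets (PiM UNIV p)" for A
  proof -
    have A_borel: "A \<in> sets borel" using A sets_P by (auto simp: null_sets_def)
    have "measure (PiM UNIV q) A = 0"
    proof (rule ccontr)
      assume "measure (PiM UNIV q) A \<noteq> 0"
      \<comment> \<open>This number is the threshold for outer regularity: an open superset of
        \<open>A\<close> with smaller measure under \<open>p\<close> violates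
        \<open>opn\<close>.\<close>
      then have pos: "(measure (PiM UNIV q) A)\<^sup>2 / C > 0" using C1 by simp
      have "emeasure (PiM UNIV p) A
          = (INF U \<in> {U. A \<subseteq> U \<and> open U}. emeasure (PiM UNIV p) U)"
        by (rule outer_regular[OF sets_P _ A_borel]) (simp add: p.P.emeasure_space_1)
      then have "(INF U \<in> {U. A \<subseteq> U \<and> open U}. emeasure (PiM UNIV p) U)
          < ennreal ((measure (PiM UNIV q) A)\<^sup>2 / C)"
        using A pos by (simp add: null_sets_def)
      then obtain U where U: "A \<subseteq> U" "open U"
          "emeasure (PiM UNIV p) U < ennreal ((measure (PiM UNIV q) A)\<^sup>2 / C)"
        by (auto simp: INF_less_iff)
      then have "measure (PiM UNIV p) U < (measure (PiM UNIV q) A)\<^sup>2 / C"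
        by (simp add: p.P.emeasure_eq_measure ennreal_less_iff)
      then have "C * measure (PiM UNIV p) U < (measure (PiM UNIV q) A)\<^sup>2"
        using C1 by (simp add: field_simps)
      also have "\<dots> \<le> (measure (PiM UNIV q) U)\<^sup>2"
        using U by (intro power_mono q.P.finite_measure_mono) (auto simp: sets_Q)
      finally show False using opn[OF U(2)] by simp
    qed
    then show ?thesis
      using A_borel by (simp add: null_sets_def q.P.emeasure_eq_measure sets_Q)
  qed
  then show ?thesis by (auto simp: absolutely_continuous_def)
qed

section \<open>Laws of independent sequences and their separation\<close>

lemma sequence_law_eq_PiM:
  assumes M: "prob_space M" and ind: "prob_space.indep_vars M (\<lambda>_. borel) X UNIV"
  shows "sequence_law M X = (\<Pi>\<^sub>M n\<in>UNIV. distr M borel (X n))"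
proof -
  interpret prob_space M by (fact M)
  have "X n \<in> borel_measurable M" for n
    using ind unfolding indep_vars_def by blast
  then have "distr M (\<Pi>\<^sub>M n\<in>UNIV. borel) (\<lambda>x. \<lambda>n\<in>UNIV. X n x) = (\<Pi>\<^sub>M n\<in>UNIV. distr M borel (X n))"
    using ind by (subst (asm) indep_vars_iff_distr_eq_PiM) auto
  then show ?thesis by (simp add: sequence_law_def restrict_def)
qed

text \<open>The \<open>k\<close>-th summand takes values between \<open>min 0 (d k)\<close> and
  \<open>max 0 (d k)\<close>, an interval of length \<open>\<bar>d k\<bar>\<close>. The squared
  lengths add up to \<open>V\<close>, so Hoeffding's exponent for a deviation of \<open>V/2\<close>
  is \<open>- 2 * (V/2)\<^sup>2 / V = - V / 2\<close>.\<close>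

lemma Hoeffding_weighted_indicators:
  assumes M: "prob_space M" and ind: "prob_space.indep_vars M (\<lambda>_. borel) X UNIV"
    and B[measurable]: "\<And>n. B n \<in> sets borel"
    and V: "V = (\<Sum>k<m. (d k)\<^sup>2)" "V > 0"
  defines "\<mu> \<equiv> \<Sum>k<m. d k * measure M (X k -` B k \<inter> space M)"
  shows "measure M {\<omega>\<in>space M. (\<Sum>k<m::nat. d k * indicator (B k) (X k \<omega>)) \<ge> \<mu> + V/2} \<le> exp (- V / 2)"
    and "measure M {\<omega>\<in>space M. (\<Sum>k<m::nat. d k * indicator (B k) (X k \<omega>)) \<le> \<mu> - V/2} \<le> exp (- V / 2)"
proof -
  interpret prob_space M by (fact M)
  have X[measurable]: "X n \<in> borel_measurable M" for n
    using ind unfolding indep_vars_def by blast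
  have E: "expectation (\<lambda>\<omega>. d k * indicator (B k) (X k \<omega>)) = d k * prob (X k -` B k \<inter> space M)" for k
  proof -
    have "expectation (\<lambda>\<omega>. indicator (B k) (X k \<omega>)) = expectation (indicator (X k -` B k \<inter> space M))"
      by (intro Bochner_Integration.integral_cong) (auto simp: indicator_def)
    also have "\<dots> = prob (X k -` B k \<inter> space M)" by simp
    finally show ?thesis by simp
  qed
  interpret H: Hoeffding_ineq M "{..<m}" "\<lambda>k \<omega>. d k * indicator (B k) (X k \<omega>)"
      "\<lambda>k. min 0 (d k)" "\<lambda>k. max 0 (d k)" \<mu>
  proof unfold_locales
    show "indep_vars (\<lambda>_. borel) (\<lambda>k \<omega>. d k * indicator (B k) (X k \<omega>)) {..<m}"
      by (rule indep_vars_subset[OF indep_vars_compose2[OF ind]]) auto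
    show "\<mu> \<equiv> \<Sum>k<m. expectation (\<lambda>\<omega>. d k * indicator (B k) (X k \<omega>))"
      unfolding E \<mu>_def .
  qed (auto simp: indicator_def)
  have sq: "(max 0 (d k) - min 0 (d k))\<^sup>2 = (d k)\<^sup>2" for k
    by (auto simp: max_def min_def)
  have e: "- 2 * (V/2)\<^sup>2 / V = - V / 2"
    using V(2) by (simp add: power2_eq_square)
  show "prob {\<omega>\<in>space M. (\<Sum>k<m. d k * indicator (B k) (X k \<omega>)) \<ge> \<mu> + V/2} \<le> exp (- V / 2)"
    using H.Hoeffding_ineq_ge[of "V/2"] V(2) unfolding sq V(1)[symmetric] e by simp
  show "prob {\<omega>\<in>space M. (\<Sum>k<m. d k * indicator (B k) (X k \<omega>)) \<le> \<mu> - V/2} \<le> exp (- V / 2)"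
    using H.Hoeffding_ineq_le[of "V/2"] V(2) unfolding sq V(1)[symmetric] e by simp
qed

text \<open>Weighting the indicators by \<open>d k\<close> makes the means of the weighted sum under
  the two laws differ by exactly \<open>V m\<close>, the sum of the squares. A threshold midway
  between the means misclassifies with probability at most \<open>exp (- V m / 2)\<close> on either
  side, and these errors become summable along a subsequence if \<open>V\<close> is
  unbounded.\<close>

lemma summable_square_if_absolutely_continuous:
  fixes U :: "nat \<Rightarrow> 'a \<Rightarrow> real" and W :: "nat \<Rightarrow> 'b \<Rightarrow> real"
  assumes M: "prob_space M" and indU: "prob_space.indep_vars M (\<lambda>_. borel) U UNIV"
    and N: "prob_space N" and indW: "prob_space.indep_vars N (\<lambda>_. borel) W UNIV"
    and B[measurable]: "\<And>n. B n \<in> sets borel"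
    and ac: "absolutely_continuous (sequence_law M U) (sequence_law N W)"
  shows "summable (\<lambda>n. (measure N (W n -` B n \<inter> space N) - measure M (U n -` B n \<inter> space M))\<^sup>2)"
proof (rule ccontr)
  interpret M: prob_space M by (fact M)
  interpret N: prob_space N by (fact N)
  define d where "d n = measure N (W n -` B n \<inter> space N) - measure M (U n -` B n \<inter> space M)" for n
  define V where "V m = (\<Sum>k<m. (d k)\<^sup>2)" for m
  define S :: "nat \<Rightarrow> (nat \<Rightarrow> real) \<Rightarrow> real"
    where "S m x = (\<Sum>k<m. d k * indicator (B k) (x k))" for m x
  define \<mu> where "\<mu> m = (\<Sum>k<m. d k * measure M (U k -` B k \<inter> space M))" for m
  have [measurable]: "U n \<in> borel_measurable M" "W n \<in> borel_measurable N" for n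
    using indU indW unfolding M.indep_vars_def N.indep_vars_def by blast+
  have seq[measurable]: "(\<lambda>\<omega> n. U n \<omega>) \<in> measurable M (\<Pi>\<^sub>M n\<in>UNIV. borel)"
      "(\<lambda>\<omega> n. W n \<omega>) \<in> measurable N (\<Pi>\<^sub>M n\<in>UNIV. borel)"
    using measurable_restrict[of UNIV U M "\<lambda>_. borel"] measurable_restrict[of UNIV W N "\<lambda>_. borel"]
    by (simp_all add: restrict_def)
  let ?P = "sequence_law M U" and ?Q = "sequence_law N W"
  have sets_P: "sets ?P = sets (\<Pi>\<^sub>M n\<in>UNIV. borel)" and sets_Q: "sets ?Q = sets (\<Pi>\<^sub>M n\<in>UNIV. borel)"
    by (simp_all add: sequence_law_def)
  interpret P: prob_space ?P unfolding sequence_law_def by (rule M.prob_space_distr) measurable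
  interpret Q: prob_space ?Q unfolding sequence_law_def by (rule N.prob_space_distr) measurable
  have S[measurable]: "S m \<in> borel_measurable (\<Pi>\<^sub>M n\<in>UNIV. borel)" for m
    unfolding S_def by measurable
  assume "\<not> summable (\<lambda>n. (measure N (W n -` B n \<inter> space N) - measure M (U n -` B n \<inter> space M))\<^sup>2)"
  then have ns: "\<not> summable (\<lambda>n. (d n)\<^sup>2)" by (simp add: d_def)
  \<comment> \<open>The term \<open>2 * real j\<close> bounds the error by
    \<open>exp (-1) ^ j\<close>, a geometric sequence; the additional 1 keeps \<open>V\<close>
    positive also for \<open>j = 0\<close>.\<close>
  have "\<exists>m. V m \<ge> 2 * real j + 1" for j
  proof (rule ccontr)
    assume "\<not> (\<exists>m. V m \<ge> 2 * real j + 1)"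
    then have "summable (\<lambda>n. (d n)\<^sup>2)"
      unfolding V_def by (intro summableI_nonneg_bounded[of _ "2 * real j + 1"]) (auto simp: not_le intro: less_imp_le)
    with ns show False by simp
  qed
  then obtain m where m: "\<And>j. V (m j) \<ge> 2 * real j + 1" by metis
  have pos: "V (m j) > 0" for j using m[of j] by linarith
  have small: "exp (- V (m j) / 2) \<le> exp (-1) ^ j" for j
    unfolding exp_of_nat_mult[symmetric] using m[of j] by simp
  have geo: "summable (\<lambda>j. exp (-1 :: real) ^ j)" by (rule summable_geometric) simp
  \<comment> \<open>The mean of \<open>S (m j)\<close> is \<open>\<mu> (m j)\<close> under the first
    law and \<open>\<mu> (m j) + V (m j)\<close> under the second; \<open>E j\<close> is cut off at
    the midpoint.\<close>
  define E where "E j = {x. S (m j) x \<ge> \<mu> (m j) + V (m j) / 2}" for j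
  have E[measurable]: "E j \<in> sets (\<Pi>\<^sub>M n\<in>UNIV. borel)" for j
  proof -
    have "E j = {x \<in> space (\<Pi>\<^sub>M n\<in>UNIV. borel). S (m j) x \<ge> \<mu> (m j) + V (m j) / 2}"
      by (simp add: E_def space_PiM PiE_UNIV_domain)
    then show ?thesis by (simp only: borel_measurable_le[OF borel_measurable_const S])
  qed
  have PE: "measure ?P (E j) \<le> exp (-1) ^ j" for j
  proof -
    have "measure ?P (E j) = measure M {\<omega>\<in>space M. S (m j) (\<lambda>n. U n \<omega>) \<ge> \<mu> (m j) + V (m j) / 2}"
      unfolding sequence_law_def
      by (subst measure_distr[OF seq(1) E]) (auto simp: E_def intro!: arg_cong[where f="measure M"])
    also have "\<dots> \<le> exp (- V (m j) / 2)"
      unfolding S_def \<mu>_def by (rule Hoeffding_weighted_indicators(1)[OF M indU B V_def pos])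
    finally show ?thesis using small[of j] by simp
  qed
  have Ec: "- E j \<in> sets (\<Pi>\<^sub>M n\<in>UNIV. borel)" for j
    using sets.compl_sets[OF E[of j]] by (simp add: space_PiM PiE_UNIV_domain flip: Compl_eq_Diff_UNIV)
  have QE: "measure ?Q (- E j) \<le> exp (-1) ^ j" for j
  proof -
    let ?\<nu> = "\<Sum>k<m j. d k * measure N (W k -` B k \<inter> space N)"
    \<comment> \<open>The means differ by the sum of \<open>d k * d k\<close>, so the midpoint also
      lies \<open>V (m j) / 2\<close> below the mean under the second law.\<close>
    have \<nu>: "?\<nu> - V (m j) = \<mu> (m j)"
      by (simp add: \<mu>_def V_def d_def power2_eq_square algebra_simps sum_subtractf sum.distrib
          flip: sum_distrib_left)
    have "measure ?Q (- E j) = measure N {\<omega>\<in>space N. S (m j) (\<lambda>n. W n \<omega>) < \<mu> (m j) + V (m j) / 2}"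
      unfolding sequence_law_def
      by (subst measure_distr[OF seq(2) Ec]) (auto simp: E_def intro!: arg_cong[where f="measure N"])
    also have "\<dots> \<le> measure N {\<omega>\<in>space N. S (m j) (\<lambda>n. W n \<omega>) \<le> ?\<nu> - V (m j) / 2}"
    proof (rule N.finite_measure_mono)
      show "{\<omega>\<in>space N. S (m j) (\<lambda>n. W n \<omega>) < \<mu> (m j) + V (m j) / 2}
          \<subseteq> {\<omega>\<in>space N. S (m j) (\<lambda>n. W n \<omega>) \<le> ?\<nu> - V (m j) / 2}"
        unfolding \<nu>[symmetric] by auto
    qed measurable
    also have "\<dots> \<le> exp (- V (m j) / 2)"
      unfolding S_def by (rule Hoeffding_weighted_indicators(2)[OF N indW B V_def pos])
    finally show ?thesis using small[of j] by simp
  qed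
  have "summable (\<lambda>j. measure ?P (E j))"
    by (rule summable_comparison_test'[OF geo, of 0]) (use PE in auto)
  then have "AE x in ?P. eventually (\<lambda>j. x \<in> space ?P - E j) sequentially"
    by (intro borel_cantelli_AE1) (auto simp: sets_P P.emeasure_eq_measure)
  \<comment> \<open>Absolute continuity carries the almost sure statement to \<open>?Q\<close>.
    There Borel-Cantelli also gives that almost every point eventually lies in \<open>E j\<close>, a
    contradiction.\<close>
  then have "AE x in ?Q. eventually (\<lambda>j. x \<in> space ?P - E j) sequentially"
    by (intro absolutely_continuous_AE[OF _ ac]) (simp_all add: sets_P sets_Q)
  moreover have "summable (\<lambda>j. measure ?Q (- E j))"
    by (rule summable_comparison_test'[OF geo, of 0]) (use QE in auto)
  then have "AE x in ?Q. eventually (\<lambda>j. x \<in> space ?Q - - E j) sequentially"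
    using Ec by (intro borel_cantelli_AE1) (auto simp: sets_Q Q.emeasure_eq_measure)
  ultimately have "AE x in ?Q. False"
  proof eventually_elim
    case (elim x)
    then have "eventually (\<lambda>j::nat. False) sequentially"
      by eventually_elim auto
    then show False by simp
  qed
  then show False by simp
qed

section \<open>Second moments of Cauchy likelihood ratios\<close>

text \<open>Nonnegativity turns the improper integral into an absolutely convergent one, so the
  limits of an antiderivative at both ends determine it.\<close>

lemma nn_integral_FTC_UNIV:
  fixes f F :: "real \<Rightarrow> real"
  assumes F: "\<And>x. DERIV F x :> f x" and f: "\<And>x. isCont f x" "\<And>x. 0 \<le> f x"
    and A: "(F \<longlongrightarrow> A) at_bot" and B: "(F \<longlongrightarrow> B) at_top"
  shows "(\<integral>\<^sup>+x. ennreal (f x) \<partial>lborel) = ennreal (B - A)"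
proof -
  have lim: "((F \<circ> real_of_ereal) \<longlongrightarrow> A) (at_right (-\<infinity>))" "((F \<circ> real_of_ereal) \<longlongrightarrow> B) (at_left \<infinity>)"
    using A B by (simp_all add: ereal_tendsto_simps)
  have "set_integrable lborel (einterval (-\<infinity>) \<infinity>) f"
    by (rule interval_integral_FTC_nonneg(1)[OF _ F f(1) _ lim]) (use f in auto)
  moreover have "(LBINT x=-\<infinity>..\<infinity>. f x) = B - A"
    by (rule interval_integral_FTC_nonneg(2)[OF _ F f(1) _ lim]) (use f in auto)
  ultimately have "integrable lborel f" "(\<integral>x. f x \<partial>lborel) = B - A"
    by (simp_all add: set_integrable_def interval_lebesgue_integral_def set_lebesgue_integral_def)
  then show ?thesis
    using f by (simp add: nn_integral_eq_integral)
qed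

lemma cauchy_density_abs: "cauchy_density \<delta> \<bar>a\<bar> = cauchy_density \<delta> a"
  by (simp add: cauchy_density_def fun_eq_iff)

lemma cauchy_density_pos: "a \<noteq> 0 \<Longrightarrow> cauchy_density \<delta> a x > 0"
  by (simp add: cauchy_density_def add_nonneg_pos)

lemma cauchy_density_measurable[measurable]: "cauchy_density \<delta> a \<in> borel_measurable borel"
  unfolding cauchy_density_def by measurable

lemma DERIV_arctan_shift_scale:
  fixes b :: real
  assumes "b > 0"
  shows "((\<lambda>x. arctan ((x - \<delta>) / b)) has_real_derivative b / ((x - \<delta>)\<^sup>2 + b\<^sup>2)) (at x)"
proof -
  define y where "y = x - \<delta>"
  have "y\<^sup>2 + b\<^sup>2 > 0" using assms by (simp add: add_nonneg_pos)
  then show ?thesis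
    using assms by (auto intro!: derivative_eq_intros simp: y_def[symmetric] field_simps power2_eq_square)
qed

text \<open>The integrand is rational with an explicit antiderivative. Its rational part vanishes at
  both ends, and only the total increase \<open>pi\<close> of the arctangent contributes.\<close>

lemma nn_integral_cauchy_density_square_div:
  assumes a: "a > 0" and b: "b > 0"
  shows "(\<integral>\<^sup>+x. ennreal ((cauchy_density \<delta> b x)\<^sup>2 / cauchy_density \<delta> a x) \<partial>lborel)
    = ennreal ((a\<^sup>2 + b\<^sup>2) / (2 * a * b))"
proof -
  let ?f = "\<lambda>x. b\<^sup>2 / (pi * a) * (((x - \<delta>)\<^sup>2 + a\<^sup>2) / ((x - \<delta>)\<^sup>2 + b\<^sup>2)\<^sup>2)"
  \<comment> \<open>With \<open>y = x - \<delta>\<close>, the numerator splits as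
    \<open>(y\<^sup>2 + b\<^sup>2) + (a\<^sup>2 - b\<^sup>2)\<close>. The two resulting terms are
    the standard antiderivatives of \<open>1 / (y\<^sup>2 + b\<^sup>2)\<close> and
    \<open>1 / (y\<^sup>2 + b\<^sup>2)\<^sup>2\<close>.\<close>
  let ?F = "\<lambda>x. b\<^sup>2 / (pi * a) * (arctan ((x - \<delta>) / b) / b
      + (a\<^sup>2 - b\<^sup>2) * ((x - \<delta>) / (2 * b\<^sup>2 * ((x - \<delta>)\<^sup>2 + b\<^sup>2)) + arctan ((x - \<delta>) / b) / (2 * b ^ 3)))"
  have nz: "(x - \<delta>)\<^sup>2 + c\<^sup>2 > 0" if "c > 0" for x c :: real
    using that by (simp add: add_nonneg_pos)
  have f: "(cauchy_density \<delta> b x)\<^sup>2 / cauchy_density \<delta> a x = ?f x" for x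
  proof -
    define A B where "A = (x - \<delta>)\<^sup>2 + a\<^sup>2" and "B = (x - \<delta>)\<^sup>2 + b\<^sup>2"
    have "A > 0" "B > 0" using nz a b by (auto simp: A_def B_def)
    then show ?thesis
      unfolding cauchy_density_def A_def[symmetric] B_def[symmetric]
      using a b by (simp add: field_simps power2_eq_square)
  qed
  have deriv: "DERIV ?F x :> ?f x" for x
  proof -
    define y where "y = x - \<delta>"
    have y: "y\<^sup>2 + b\<^sup>2 > 0" using nz[OF b] by (simp add: y_def)
    have at: "((\<lambda>x. arctan ((x - \<delta>) / b)) has_real_derivative b / (y\<^sup>2 + b\<^sup>2)) (at x)"
      unfolding y_def by (rule DERIV_arctan_shift_scale[OF b])
    have rat: "((\<lambda>x. (x - \<delta>) / (2 * b\<^sup>2 * ((x - \<delta>)\<^sup>2 + b\<^sup>2))) has_real_derivative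
        (b\<^sup>2 - y\<^sup>2) / (2 * b\<^sup>2 * (y\<^sup>2 + b\<^sup>2)\<^sup>2)) (at x)"
    proof -
      have "((\<lambda>x. 2 * b\<^sup>2 * ((x - \<delta>)\<^sup>2 + b\<^sup>2)) has_real_derivative 2 * b\<^sup>2 * (2 * y)) (at x)"
        by (auto intro!: derivative_eq_intros simp: y_def)
      moreover have "((\<lambda>x. x - \<delta>) has_real_derivative 1) (at x)"
        by (auto intro!: derivative_eq_intros)
      moreover have "2 * b\<^sup>2 * ((x - \<delta>)\<^sup>2 + b\<^sup>2) \<noteq> 0"
        using b y by (simp add: y_def)
      ultimately have "((\<lambda>x. (x - \<delta>) / (2 * b\<^sup>2 * ((x - \<delta>)\<^sup>2 + b\<^sup>2))) has_real_derivative
          (1 * (2 * b\<^sup>2 * ((x - \<delta>)\<^sup>2 + b\<^sup>2)) - (x - \<delta>) * (2 * b\<^sup>2 * (2 * y))) /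
          ((2 * b\<^sup>2 * ((x - \<delta>)\<^sup>2 + b\<^sup>2)) * (2 * b\<^sup>2 * ((x - \<delta>)\<^sup>2 + b\<^sup>2)))) (at x)"
        by (intro DERIV_divide)
      also have "(1 * (2 * b\<^sup>2 * ((x - \<delta>)\<^sup>2 + b\<^sup>2)) - (x - \<delta>) * (2 * b\<^sup>2 * (2 * y))) /
          ((2 * b\<^sup>2 * ((x - \<delta>)\<^sup>2 + b\<^sup>2)) * (2 * b\<^sup>2 * ((x - \<delta>)\<^sup>2 + b\<^sup>2)))
          = (2 * b\<^sup>2 * (b\<^sup>2 - y\<^sup>2)) / (2 * b\<^sup>2 * (2 * b\<^sup>2 * (y\<^sup>2 + b\<^sup>2)\<^sup>2))"
        unfolding y_def[symmetric]
        by (rule arg_cong2[where f = "(/)"]) (simp_all add: algebra_simps power2_eq_square)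
      also have "\<dots> = (b\<^sup>2 - y\<^sup>2) / (2 * b\<^sup>2 * (y\<^sup>2 + b\<^sup>2)\<^sup>2)"
        using b by (intro mult_divide_mult_cancel_left) auto
      finally show ?thesis .
    qed
    have "DERIV ?F x :> b\<^sup>2 / (pi * a) * (b / (y\<^sup>2 + b\<^sup>2) / b + (a\<^sup>2 - b\<^sup>2) *
        ((b\<^sup>2 - y\<^sup>2) / (2 * b\<^sup>2 * (y\<^sup>2 + b\<^sup>2)\<^sup>2) + b / (y\<^sup>2 + b\<^sup>2) / (2 * b ^ 3)))"
      by (intro DERIV_cmult DERIV_add DERIV_cdivide at rat)
    also have "b / (y\<^sup>2 + b\<^sup>2) / b + (a\<^sup>2 - b\<^sup>2) *
        ((b\<^sup>2 - y\<^sup>2) / (2 * b\<^sup>2 * (y\<^sup>2 + b\<^sup>2)\<^sup>2) + b / (y\<^sup>2 + b\<^sup>2) / (2 * b ^ 3))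
        = (y\<^sup>2 + a\<^sup>2) / (y\<^sup>2 + b\<^sup>2)\<^sup>2"
    proof -
      \<comment> \<open>Eliminating \<open>y\<^sup>2\<close> in favour of \<open>D\<close> leaves a
        rational identity in \<open>D\<close>, \<open>a\<close> and \<open>b\<close> with nonzero
        denominators.\<close>
      define D where "D = y\<^sup>2 + b\<^sup>2"
      have D: "D > 0" "y\<^sup>2 = D - b\<^sup>2" using y by (auto simp: D_def)
      show ?thesis unfolding D_def[symmetric] D(2) using D(1) b
        by (simp add: divide_simps) (simp add: algebra_simps power2_eq_square power3_eq_cube)
    qed
    finally show ?thesis by (simp add: y_def)
  qed
  have at_top: "((\<lambda>x. arctan ((x - \<delta>) / b)) \<longlongrightarrow> pi / 2) at_top"
    using b by real_asymp
  have at_bot: "((\<lambda>x. arctan ((x - \<delta>) / b)) \<longlongrightarrow> - (pi / 2)) at_bot"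
    using b by real_asymp
  have rat_top: "((\<lambda>x. (x - \<delta>) / (2 * b\<^sup>2 * ((x - \<delta>)\<^sup>2 + b\<^sup>2))) \<longlongrightarrow> 0) at_top"
    using b by real_asymp
  have rat_bot: "((\<lambda>x. (x - \<delta>) / (2 * b\<^sup>2 * ((x - \<delta>)\<^sup>2 + b\<^sup>2))) \<longlongrightarrow> 0) at_bot"
    using b by real_asymp
  have top: "(?F \<longlongrightarrow> b\<^sup>2 / (pi * a) * (pi / 2 / b + (a\<^sup>2 - b\<^sup>2) * (0 + pi / 2 / (2 * b ^ 3)))) at_top"
    by (intro tendsto_intros at_top rat_top) (use b in auto)
  have bot: "(?F \<longlongrightarrow> b\<^sup>2 / (pi * a) * (- (pi / 2) / b + (a\<^sup>2 - b\<^sup>2) * (0 + - (pi / 2) / (2 * b ^ 3)))) at_bot"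
    by (intro tendsto_intros at_bot rat_bot) (use b in auto)
  have "(\<integral>\<^sup>+x. ennreal (?f x) \<partial>lborel)
      = ennreal (b\<^sup>2 / (pi * a) * (pi / 2 / b + (a\<^sup>2 - b\<^sup>2) * (0 + pi / 2 / (2 * b ^ 3)))
        - b\<^sup>2 / (pi * a) * (- (pi / 2) / b + (a\<^sup>2 - b\<^sup>2) * (0 + - (pi / 2) / (2 * b ^ 3))))"
  proof (rule nn_integral_FTC_UNIV[OF deriv _ _ bot top])
    show "isCont ?f x" for x using nz[OF b, of x] b a by (intro continuous_intros) auto
    show "0 \<le> ?f x" for x using a by simp
  qed
  also have "b\<^sup>2 / (pi * a) * (pi / 2 / b + (a\<^sup>2 - b\<^sup>2) * (0 + pi / 2 / (2 * b ^ 3)))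
        - b\<^sup>2 / (pi * a) * (- (pi / 2) / b + (a\<^sup>2 - b\<^sup>2) * (0 + - (pi / 2) / (2 * b ^ 3)))
      = (a\<^sup>2 + b\<^sup>2) / (2 * a * b)"
    using a b by (simp add: divide_simps) (simp add: algebra_simps power2_eq_square power3_eq_cube)
  finally show ?thesis unfolding f .
qed

text \<open>The value is written as 1 plus the chi-square divergence, so that products of such
  factors can be bounded by the exponential of a sum.\<close>

lemma nn_integral_cauchy_likelihood_ratio_square:
  assumes a: "a \<noteq> 0" and b: "b \<noteq> 0"
  shows "(\<integral>\<^sup>+x. (ennreal (cauchy_density \<delta> b x / cauchy_density \<delta> a x))\<^sup>2
      \<partial>density lborel (\<lambda>x. ennreal (cauchy_density \<delta> a x)))
    = ennreal (1 + (\<bar>b\<bar> - \<bar>a\<bar>)\<^sup>2 / (2 * \<bar>a\<bar> * \<bar>b\<bar>))"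
proof -
  have pos: "cauchy_density \<delta> a x > 0" "cauchy_density \<delta> b x > 0" for x
    using a b by (auto intro: cauchy_density_pos)
  have "(\<integral>\<^sup>+x. (ennreal (cauchy_density \<delta> b x / cauchy_density \<delta> a x))\<^sup>2
      \<partial>density lborel (\<lambda>x. ennreal (cauchy_density \<delta> a x)))
    = (\<integral>\<^sup>+x. ennreal (cauchy_density \<delta> a x) *
        (ennreal (cauchy_density \<delta> b x / cauchy_density \<delta> a x))\<^sup>2 \<partial>lborel)"
    by (rule nn_integral_density) measurable
  also have "\<dots> = (\<integral>\<^sup>+x. ennreal ((cauchy_density \<delta> \<bar>b\<bar> x)\<^sup>2 / cauchy_density \<delta> \<bar>a\<bar> x) \<partial>lborel)"
  proof (rule nn_integral_cong)
    fix x
    show "ennreal (cauchy_density \<delta> a x) * (ennreal (cauchy_density \<delta> b x / cauchy_density \<delta> a x))\<^sup>2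
        = ennreal ((cauchy_density \<delta> \<bar>b\<bar> x)\<^sup>2 / cauchy_density \<delta> \<bar>a\<bar> x)"
      using pos[of x]
      by (simp add: cauchy_density_abs ennreal_power less_imp_le flip: ennreal_mult)
         (simp add: power2_eq_square)
  qed
  also have "\<dots> = ennreal ((\<bar>a\<bar>\<^sup>2 + \<bar>b\<bar>\<^sup>2) / (2 * \<bar>a\<bar> * \<bar>b\<bar>))"
    using a b by (intro nn_integral_cauchy_density_square_div) auto
  also have "(\<bar>a\<bar>\<^sup>2 + \<bar>b\<bar>\<^sup>2) / (2 * \<bar>a\<bar> * \<bar>b\<bar>) = 1 + (\<bar>b\<bar> - \<bar>a\<bar>)\<^sup>2 / (2 * \<bar>a\<bar> * \<bar>b\<bar>)"
    using a b by (simp add: field_simps power2_diff del: power2_abs)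
  finally show ?thesis .
qed

section \<open>Interval probabilities of Cauchy variables and comparison of series\<close>

lemma distr_cauchy_rv:
  "cauchy_rv M X \<delta> \<gamma> \<Longrightarrow> distr M borel X = density lborel (\<lambda>x. ennreal (cauchy_density \<delta> \<gamma> x))"
  unfolding cauchy_rv_def distributed_def by (metis distr_cong sets_lborel)

text \<open>The density has antiderivative
  \<open>arctan ((x - \<delta>) / \<bar>a\<bar>) / pi\<close>. A half-width \<open>c\<close> equal
  to the scale gives probability 1/2, the reference value in the comparison below.\<close>

lemma cauchy_rv_measure_Icc:
  assumes X: "cauchy_rv M X \<delta> a" and a: "a \<noteq> 0" and c: "c > 0"
  shows "measure M (X -` {\<delta> - c..\<delta> + c} \<inter> space M) = 2 / pi * arctan (c / \<bar>a\<bar>)"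
proof -
  have "emeasure M (X -` {\<delta> - c..\<delta> + c} \<inter> space M)
      = (\<integral>\<^sup>+x. ennreal (cauchy_density \<delta> a x) * indicator {\<delta> - c..\<delta> + c} x \<partial>lborel)"
    using X unfolding cauchy_rv_def by (intro distributed_emeasure) auto
  also have "\<dots> = ennreal (arctan ((\<delta> + c - \<delta>) / \<bar>a\<bar>) / pi - arctan ((\<delta> - c - \<delta>) / \<bar>a\<bar>) / pi)"
  proof (rule nn_integral_FTC_Icc)
    fix x
    have "cauchy_density \<delta> c x = c / ((x - \<delta>)\<^sup>2 + c\<^sup>2) / pi" if "c > 0" for c
      using that by (simp add: cauchy_density_def power2_eq_square)
    then have "((\<lambda>x. arctan ((x - \<delta>) / \<bar>a\<bar>) / pi) has_real_derivative cauchy_density \<delta> \<bar>a\<bar> x) (at x)"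
      using DERIV_cdivide[OF DERIV_arctan_shift_scale[of "\<bar>a\<bar>" \<delta> x], of pi] a by simp
    then show "((\<lambda>x. arctan ((x - \<delta>) / \<bar>a\<bar>) / pi) has_real_derivative cauchy_density \<delta> a x) (at x)"
      by (simp add: cauchy_density_abs)
  qed (use a c in \<open>auto intro!: less_imp_le[OF cauchy_density_pos]\<close>)
  also have "arctan ((\<delta> + c - \<delta>) / \<bar>a\<bar>) / pi - arctan ((\<delta> - c - \<delta>) / \<bar>a\<bar>) / pi = 2 / pi * arctan (c / \<bar>a\<bar>)"
    by (simp add: arctan_minus field_simps)
  finally show ?thesis
    using c by (simp add: measure_def)
qed

text \<open>By the mean value theorem: the derivative \<open>1 / (1 + z\<^sup>2)\<close> of the
  arctangent is at least 1/5 on the interval from 0 to 2.\<close>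

lemma abs_diff_le_arctan:
  fixes t :: real
  assumes "0 \<le> t" "t \<le> 2"
  shows "\<bar>t - 1\<bar> \<le> 5 * \<bar>arctan t - pi / 4\<bar>"
proof (cases "t = 1")
  case False
  have "\<exists>z. 0 \<le> z \<and> z \<le> 2 \<and> arctan t - arctan 1 = (t - 1) * inverse (1 + z\<^sup>2)"
  proof (cases "t > 1")
    case True
    then obtain z where "1 < z" "z < t" "arctan t - arctan 1 = (t - 1) * inverse (1 + z\<^sup>2)"
      using MVT2[of 1 t arctan "\<lambda>x. inverse (1 + x\<^sup>2)"] by (auto intro: DERIV_arctan)
    then show ?thesis using assms by (intro exI[of _ z]) auto
  next
    case f: False
    with False obtain z where "t < z" "z < 1" "arctan 1 - arctan t = (1 - t) * inverse (1 + z\<^sup>2)"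
      using MVT2[of t 1 arctan "\<lambda>x. inverse (1 + x\<^sup>2)"] by (auto intro: DERIV_arctan)
    then show ?thesis using assms by (intro exI[of _ z]) (auto simp: algebra_simps)
  qed
  then obtain z where z: "0 \<le> z" "z \<le> 2" "arctan t - arctan 1 = (t - 1) * inverse (1 + z\<^sup>2)"
    by blast
  have "z\<^sup>2 \<le> 2\<^sup>2" using z by (intro power_mono) auto
  then have "1 + z\<^sup>2 \<le> 5" by simp
  moreover have "1 + z\<^sup>2 > 0" by (simp add: add_pos_nonneg)
  then have "t - 1 = (1 + z\<^sup>2) * (arctan t - pi / 4)"
    using z(3) by (simp add: arctan_one)
  then have "\<bar>t - 1\<bar> = (1 + z\<^sup>2) * \<bar>arctan t - pi / 4\<bar>"
    using \<open>1 + z\<^sup>2 > 0\<close> by (metis abs_mult abs_of_pos)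
  ultimately show ?thesis by (simp add: mult_right_mono)
qed simp

text \<open>Summable terms tend to 0, which eventually confines \<open>1 / s n\<close> to a
  neighbourhood of 1. There \<open>\<bar>s n - 1\<bar>\<close> is at most a constant times
  \<open>\<bar>arctan (1 / s n) - pi / 4\<bar>\<close>.\<close>

lemma summable_square_diff_if_arctan:
  fixes s :: "nat \<Rightarrow> real"
  assumes s: "\<And>n. s n > 0" and sum: "summable (\<lambda>n. (2 / pi * arctan (1 / s n) - 1 / 2)\<^sup>2)"
  shows "summable (\<lambda>n. (s n - 1)\<^sup>2)"
proof -
  have eq: "2 / pi * arctan (1 / s n) - 1 / 2 = 2 / pi * (arctan (1 / s n) - pi / 4)" for n
    by (simp add: field_simps)
  have "summable (\<lambda>n. (pi / 2)\<^sup>2 * (2 / pi * (arctan (1 / s n) - pi / 4))\<^sup>2)"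
    using sum unfolding eq by (rule summable_mult)
  also have "(\<lambda>n. (pi / 2)\<^sup>2 * (2 / pi * (arctan (1 / s n) - pi / 4))\<^sup>2) = (\<lambda>n. (arctan (1 / s n) - pi / 4)\<^sup>2)"
  proof -
    have "(pi / 2)\<^sup>2 * (2 / pi * u)\<^sup>2 = u\<^sup>2" for u
      by (simp add: power_mult_distrib power_divide)
    then show ?thesis by blast
  qed
  finally have sum': "summable (\<lambda>n. (arctan (1 / s n) - pi / 4)\<^sup>2)" .
  then have "(\<lambda>n. (arctan (1 / s n) - pi / 4)\<^sup>2) \<longlonglongrightarrow> 0"
    by (rule summable_LIMSEQ_zero)
  \<comment> \<open>The threshold 1/10 makes \<open>5 * \<bar>arctan t - pi / 4\<bar>\<close>
    smaller than 1/2, hence \<open>t \<ge> 1/2\<close> for \<open>t = 1 / s n\<close>. The factor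
    100 below is the square of 5 * 2, where 2 bounds \<open>1 / t\<close>.\<close>
  then have "eventually (\<lambda>n. (arctan (1 / s n) - pi / 4)\<^sup>2 < (1/10)\<^sup>2) sequentially"
    by (rule order_tendstoD) simp
  then have "eventually (\<lambda>n. norm ((s n - 1)\<^sup>2) \<le> 100 * (arctan (1 / s n) - pi / 4)\<^sup>2) sequentially"
  proof eventually_elim
    case (elim n)
    define t where "t = 1 / s n"
    have t: "t > 0" "s n = 1 / t" using s[of n] by (auto simp: t_def)
    have small: "\<bar>arctan t - pi / 4\<bar> < 1/10"
      using elim power2_less_imp_less[of "\<bar>arctan t - pi / 4\<bar>" "1/10"] by (simp add: t_def)
    \<comment> \<open>The arctangent bound taken at 2 puts \<open>arctan 2\<close> at least 1/5
      above \<open>pi / 4\<close>; by monotonicity a larger \<open>t\<close> would be too far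
      away.\<close>
    have "t \<le> 2"
    proof (rule ccontr)
      assume "\<not> t \<le> 2"
      then have "arctan 2 < arctan t" by (simp add: arctan_less_iff)
      moreover have "1 \<le> 5 * \<bar>arctan 2 - pi / 4\<bar>" using abs_diff_le_arctan[of 2] by simp
      moreover have "arctan 1 < arctan 2" by (rule arctan_monotone) simp
      ultimately show False using small by (simp add: arctan_one)
    qed
    then have le: "\<bar>t - 1\<bar> \<le> 5 * \<bar>arctan t - pi / 4\<bar>"
      using t by (intro abs_diff_le_arctan) auto
    have "5 * \<bar>arctan t - pi / 4\<bar> < 1/2" using small by simp
    with le have "\<bar>t - 1\<bar> < 1/2" by (rule order_le_less_trans)
    then have "t \<ge> 1/2" by linarith
    have "s n - 1 = - (t - 1) / t" using t by (simp add: field_simps)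
    then have "\<bar>s n - 1\<bar> = \<bar>t - 1\<bar> / t" using t by (simp only: abs_divide abs_minus_cancel abs_of_pos)
    also have "\<dots> \<le> \<bar>t - 1\<bar> / (1/2)"
      using \<open>t \<ge> 1/2\<close> by (intro divide_left_mono) auto
    also have "\<dots> \<le> 10 * \<bar>arctan t - pi / 4\<bar>" using le by simp
    finally have "\<bar>s n - 1\<bar>\<^sup>2 \<le> (10 * \<bar>arctan t - pi / 4\<bar>)\<^sup>2"
      by (intro power_mono) auto
    then show ?case by (simp add: power_mult_distrib t_def)
  qed
  then show ?thesis
    by (rule summable_comparison_test_ev) (intro summable_mult sum')
qed

text \<open>Since \<open>s n\<close> tends to 1, the denominator \<open>2 * s n\<close> is
  eventually at least 1.\<close>

lemma summable_cauchy_divergence: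
  fixes s :: "nat \<Rightarrow> real"
  assumes s: "\<And>n. s n > 0" and sum: "summable (\<lambda>n. (s n - 1)\<^sup>2)"
  shows "summable (\<lambda>n. (s n - 1)\<^sup>2 / (2 * s n))"
proof -
  have "(\<lambda>n. (s n - 1)\<^sup>2) \<longlonglongrightarrow> 0"
    using sum by (rule summable_LIMSEQ_zero)
  then have "eventually (\<lambda>n. (s n - 1)\<^sup>2 < (1/2)\<^sup>2) sequentially"
    by (rule order_tendstoD) simp
  then have "eventually (\<lambda>n. norm ((s n - 1)\<^sup>2 / (2 * s n)) \<le> (s n - 1)\<^sup>2) sequentially"
  proof eventually_elim
    case (elim n)
    then have "\<bar>s n - 1\<bar> < 1/2"
      using power2_less_imp_less[of "\<bar>s n - 1\<bar>" "1/2"] by simp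
    then have "1 \<le> 2 * s n" by linarith
    then have "(s n - 1)\<^sup>2 * 1 \<le> (s n - 1)\<^sup>2 * (2 * s n)" by (intro mult_left_mono) auto
    then show ?case using s[of n] by (simp add: field_simps)
  qed
  then show ?thesis by (rule summable_comparison_test_ev) (fact sum)
qed

section \<open>Equivalence of Cauchy product laws\<close>

text \<open>By \<open>1 + t \<le> exp t\<close>, every finite product of second moments is at most
  the exponential of the summed divergences. Both scale sequences are general, so that the lemma can
  be applied a second time with the scales exchanged.\<close>

lemma absolutely_continuous_PiM_cauchy:
  fixes \<delta> a b :: "nat \<Rightarrow> real"
  defines "p \<equiv> \<lambda>n. density lborel (\<lambda>x. ennreal (cauchy_density (\<delta> n) (a n) x))"
    and "q \<equiv> \<lambda>n. density lborel (\<lambda>x. ennreal (cauchy_density (\<delta> n) (b n) x))"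
  assumes p: "\<And>n. prob_space (p n)" and q: "\<And>n. prob_space (q n)"
    and a: "\<And>n. a n \<noteq> 0" and b: "\<And>n. b n \<noteq> 0"
    and sum: "summable (\<lambda>n. (\<bar>b n\<bar> - \<bar>a n\<bar>)\<^sup>2 / (2 * \<bar>a n\<bar> * \<bar>b n\<bar>))"
  shows "absolutely_continuous (PiM UNIV p) (PiM UNIV q)"
proof (rule absolutely_continuous_PiM[OF p q])
  let ?r = "\<lambda>n x. ennreal (cauchy_density (\<delta> n) (b n) x / cauchy_density (\<delta> n) (a n) x)"
  let ?t = "\<lambda>n. (\<bar>b n\<bar> - \<bar>a n\<bar>)\<^sup>2 / (2 * \<bar>a n\<bar> * \<bar>b n\<bar>)"
  show "sets (p n) = sets borel" for n by (simp add: p_def)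
  show "?r n \<in> borel_measurable (p n)" for n unfolding p_def by measurable
  show "q n = density (p n) (?r n)" for n
    unfolding p_def q_def
  proof (subst density_density_eq)
    have "ennreal (cauchy_density (\<delta> n) (b n) x) = ennreal (cauchy_density (\<delta> n) (a n) x) * ?r n x" for x
      using cauchy_density_pos[OF a[of n], of "\<delta> n" x] cauchy_density_pos[OF b[of n], of "\<delta> n" x]
      by (simp add: less_imp_le flip: ennreal_mult)
    then show "density lborel (\<lambda>x. ennreal (cauchy_density (\<delta> n) (b n) x))
        = density lborel (\<lambda>x. ennreal (cauchy_density (\<delta> n) (a n) x) * ?r n x)"
      by simp
  qed measurable
  fix J :: "nat set" assume J: "finite J"
  have "(\<Prod>n\<in>J. \<integral>\<^sup>+x. (?r n x)\<^sup>2 \<partial>p n) = (\<Prod>n\<in>J. ennreal (1 + ?t n))"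
    unfolding p_def by (simp only: nn_integral_cauchy_likelihood_ratio_square[OF a b])
  also have "\<dots> = ennreal (\<Prod>n\<in>J. 1 + ?t n)"
    by (intro prod_ennreal) auto
  also have "\<dots> \<le> ennreal (exp (suminf ?t))"
  proof (rule ennreal_leI)
    have "(\<Prod>n\<in>J. 1 + ?t n) \<le> (\<Prod>n\<in>J. exp (?t n))"
      by (intro prod_mono conjI exp_ge_add_one_self) auto
    also have "\<dots> = exp (\<Sum>n\<in>J. ?t n)" using J by (simp add: exp_sum)
    also have "\<dots> \<le> exp (suminf ?t)"
      using J sum by (auto intro!: sum_le_suminf)
    finally show "(\<Prod>n\<in>J. 1 + ?t n) \<le> exp (suminf ?t)" .
  qed
  finally show "(\<Prod>n\<in>J. \<integral>\<^sup>+x. (?r n x)\<^sup>2 \<partial>p n) \<le> ennreal (exp (suminf ?t))" .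
qed

theorem theorem1p1:
  fixes \<delta> \<gamma> \<sigma> :: "nat \<Rightarrow> real"
    and M :: "'a measure" and N :: "'b measure"
    and U :: "nat \<Rightarrow> 'a \<Rightarrow> real" and W :: "nat \<Rightarrow> 'b \<Rightarrow> real"
  assumes "\<And>n. \<gamma> n > 0"
    and "\<And>n. \<sigma> n \<noteq> 0"
    and "prob_space M"
    and "prob_space.indep_vars M (\<lambda>_. borel) U UNIV"
    and "\<And>n. cauchy_rv M (U n) (\<delta> n) (\<gamma> n)"
    and "prob_space N"
    and "prob_space.indep_vars N (\<lambda>_. borel) W UNIV"
    and "\<And>n. cauchy_rv N (W n) (\<delta> n) (\<sigma> n * \<gamma> n)"
  shows "equivalent_measures (sequence_law M U) (sequence_law N W) \<longleftrightarrow>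
           summable (\<lambda>n. (\<bar>\<sigma> n\<bar> - 1)\<^sup>2)"
proof
  have \<gamma>: "\<gamma> n \<noteq> 0" and \<sigma>\<gamma>: "\<sigma> n * \<gamma> n \<noteq> 0" for n
    using assms(1)[of n] assms(2)[of n] by auto
  {
    assume "equivalent_measures (sequence_law M U) (sequence_law N W)"
    then have "absolutely_continuous (sequence_law M U) (sequence_law N W)"
      by (simp add: equivalent_measures_def)
    \<comment> \<open>The window has the scale of \<open>U n\<close> as half-width: its probability
      is 1/2 for \<open>U n\<close> and depends only on \<open>\<bar>\<sigma> n\<bar>\<close> for
      \<open>W n\<close>.\<close>
    from summable_square_if_absolutely_continuous[OF assms(3,4,6,7) _ this,
        of "\<lambda>n. {\<delta> n - \<gamma> n..\<delta> n + \<gamma> n}"]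
    have "summable (\<lambda>n. (2 / pi * arctan (\<gamma> n / \<bar>\<sigma> n * \<gamma> n\<bar>) - 2 / pi * arctan (\<gamma> n / \<bar>\<gamma> n\<bar>))\<^sup>2)"
      by (simp only: cauchy_rv_measure_Icc[OF assms(5) \<gamma> assms(1)]
          cauchy_rv_measure_Icc[OF assms(8) \<sigma>\<gamma> assms(1)]) simp
    also have "(\<lambda>n. (2 / pi * arctan (\<gamma> n / \<bar>\<sigma> n * \<gamma> n\<bar>) - 2 / pi * arctan (\<gamma> n / \<bar>\<gamma> n\<bar>))\<^sup>2)
        = (\<lambda>n. (2 / pi * arctan (1 / \<bar>\<sigma> n\<bar>) - 1 / 2)\<^sup>2)"
    proof
      fix n
      have "\<gamma> n / \<bar>\<sigma> n * \<gamma> n\<bar> = 1 / \<bar>\<sigma> n\<bar>" "\<gamma> n / \<bar>\<gamma> n\<bar> = 1"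
        using assms(1)[of n] by (auto simp: abs_mult)
      then show "(2 / pi * arctan (\<gamma> n / \<bar>\<sigma> n * \<gamma> n\<bar>) - 2 / pi * arctan (\<gamma> n / \<bar>\<gamma> n\<bar>))\<^sup>2
          = (2 / pi * arctan (1 / \<bar>\<sigma> n\<bar>) - 1 / 2)\<^sup>2"
        by (simp add: arctan_one)
    qed
    finally show "summable (\<lambda>n. (\<bar>\<sigma> n\<bar> - 1)\<^sup>2)"
      using assms(2) by (intro summable_square_diff_if_arctan) auto
  }
  {
    assume "summable (\<lambda>n. (\<bar>\<sigma> n\<bar> - 1)\<^sup>2)"
    then have sum: "summable (\<lambda>n. (\<bar>\<sigma> n\<bar> - 1)\<^sup>2 / (2 * \<bar>\<sigma> n\<bar>))"
      using assms(2) by (intro summable_cauchy_divergence) auto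
    \<comment> \<open>The divergence is invariant under a common rescaling, so
      \<open>\<gamma> n\<close> cancels.\<close>
    have eq: "(\<bar>\<sigma> n * \<gamma> n\<bar> - \<bar>\<gamma> n\<bar>)\<^sup>2 / (2 * \<bar>\<gamma> n\<bar> * \<bar>\<sigma> n * \<gamma> n\<bar>) = (\<bar>\<sigma> n\<bar> - 1)\<^sup>2 / (2 * \<bar>\<sigma> n\<bar>)" for n
    proof -
      have "\<bar>\<sigma> n * \<gamma> n\<bar> - \<bar>\<gamma> n\<bar> = \<bar>\<gamma> n\<bar> * (\<bar>\<sigma> n\<bar> - 1)"
        by (simp add: abs_mult algebra_simps)
      then show ?thesis
        using \<gamma>[of n] by (simp add: abs_mult power_mult_distrib power2_eq_square)
    qed
    have eq': "(\<bar>\<gamma> n\<bar> - \<bar>\<sigma> n * \<gamma> n\<bar>)\<^sup>2 / (2 * \<bar>\<sigma> n * \<gamma> n\<bar> * \<bar>\<gamma> n\<bar>) = (\<bar>\<sigma> n\<bar> - 1)\<^sup>2 / (2 * \<bar>\<sigma> n\<bar>)" for n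
      using eq[of n] by (simp add: power2_commute mult_ac)
    let ?p = "\<lambda>n. density lborel (\<lambda>x. ennreal (cauchy_density (\<delta> n) (\<gamma> n) x))"
    let ?q = "\<lambda>n. density lborel (\<lambda>x. ennreal (cauchy_density (\<delta> n) (\<sigma> n * \<gamma> n) x))"
    have meas: "U n \<in> borel_measurable M" "W n \<in> borel_measurable N" for n
      using assms(4,7) unfolding prob_space.indep_vars_def[OF assms(3)] prob_space.indep_vars_def[OF assms(6)]
      by blast+
    \<comment> \<open>Each density measure is the law of a given random variable, so its total mass
      is 1 without integrating the density.\<close>
    have p: "prob_space (?p n)" and q: "prob_space (?q n)" for n
      using prob_space.prob_space_distr[OF assms(3) meas(1)[of n]]
        prob_space.prob_space_distr[OF assms(6) meas(2)[of n]]
      by (simp_all add: distr_cauchy_rv[OF assms(5)] distr_cauchy_rv[OF assms(8)])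
    have law: "sequence_law M U = PiM UNIV ?p" "sequence_law N W = PiM UNIV ?q"
      by (simp_all add: sequence_law_eq_PiM assms(3,4,6,7) distr_cauchy_rv[OF assms(5)]
          distr_cauchy_rv[OF assms(8)])
    have "sets (sequence_law M U) = sets (sequence_law N W)"
      by (simp add: sequence_law_def)
    moreover have "absolutely_continuous (PiM UNIV ?p) (PiM UNIV ?q)"
      by (rule absolutely_continuous_PiM_cauchy) (simp_all only: p q \<gamma> \<sigma>\<gamma> eq sum not_False_eq_True)
    moreover have "absolutely_continuous (PiM UNIV ?q) (PiM UNIV ?p)"
      by (rule absolutely_continuous_PiM_cauchy) (simp_all only: p q \<gamma> \<sigma>\<gamma> eq' sum not_False_eq_True)
    ultimately show "equivalent_measures (sequence_law M U) (sequence_law N W)"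
      unfolding equivalent_measures_def law by blast
  }
qed

end
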